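(* Let $\mathcal{P}=(V,E,r,\mu,\delta)$ be an optimistic DAG MPCS protocol for a contract $\mathfrak{C}$ with finite set of signers $A$, without in-role parallelism (i.e. for each signer $P\in A$, the vertices $v$ with $r(v)=P$ are totally ordered by $\preceq$). Let $$I=\{v\in\mathit{InitSet}(\mathcal{P}) : \text{for all } w,\ (v\prec w\ \wedge\ r(v)=r(w))\Rightarrow w\notin\mathit{InitSet}(\mathcal{P})\}.$$ Let $P\in A$ be a signer such that for every $v\in\mathit{SigSet}(\mathcal{P})$ with $r(v)=P$ the paths from $I$ to $v$ contain all permutations of $A\setminus\{P\}$, i.e. for every permutation of the elements of $A\setminus\{P\}$ there is a sequence in $\mathrm{seq}(I,v)$ containing it as a (not necessarily consecutive) subsequence. Then $\mathcal{P}$ is fair for $P$, i.e. every execution of $\mathcal{P}$ in which $P$ is honest is fair for $P$.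
   Context: **Causality.** For a finite directed acyclic graph $(V,E)$ and $v,w\in V$, $v\prec w$ means there is a directed path (of length $\ge 1$) from $v$ to $w$; $v\preceq w$ means $v\prec w$ or $v=w$. This extends to $V\cup E$: $(v,w)\prec(v',w')$ iff $w\preceq v'$; $v\prec(v',w')$ iff $v\preceq v'$; $(v,w)\prec v'$ iff $w\preceq v'$. A set $S\subseteq V\cup E$ is causally closed if $x\in S$ and $y\prec x$ imply $y\in S$. $\mathrm{in}(v)$ is the set of edges with target $v$. **Paths.** For $I\subseteq V$, $v\in V$: $\mathrm{path}(I,v)$ is the set of sequences $(v_1,\dots,v_m)$ of vertices with $v_1\in I$, $v_m=v$ and $(v_i,v_{i+1})\in E$ for $1\le i<m$; $\mathrm{seq}(I,v)$ is the set of role sequences $(r(v_1),\dots,r(v_m))$ with $(v_1,\dots,v_m)\in\mathrm{path}(I,v)$. **DAG protocol specification.** Let $R$ be a set of roles, $T\notin R$ the trusted third party (TTP), $M$ a set of messages, $\varepsilon,\mathit{exit}\notin M$ two symbols. A DAG protocol specification is $\mathcal{P}=(V,E,r,\mu,\delta)$ with $(V,E)$ a finite DAG, $r:V\to R\cup\{T\}$, $\mu:E\to M\cup\{\varepsilon,\mathit{exit}\}$ such that $\mu(v,v')=\varepsilon$ implies $r(v)=r(v')$ and $\mu(v,v')=\mathit{exit}$ implies $r(v')=T$, and $\delta:M^*\to M$ a function giving the replies of the TTP. Edges with label in $M$ are message edges. **DAG MPCS protocol specification.** Let $A\subset R$ be a finite set of signers, $\mathfrak{C}$ a contract, $\mathit{SigSet}\subseteq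 V$. $\mathcal{P}$ is a DAG MPCS protocol (specification) for $\mathfrak{C}$ if: 1. there is a unique $v_T\in V$ with $r(v_T)=T$, $(v,v_T)\in E$ for all $v\in V\setminus\{v_T\}$, and $r(v)\in A$ for $v\ne v_T$; 2. for all $v,w\in V$: if $v\prec w$ then $(v,w)\in E$ or there is $u\in V$ with $v\prec u\prec w$ and $r(u)\in\{r(v),r(w)\}$; 3. for $(v,w)\in E$: $\mu(v,w)=\varepsilon$ if $r(v)=r(w)$; $\mu(v,w)=\mathit{exit}$ if $w=v_T$; $\mu(v,w)$ is the signature $\mathcal{S}_{r(v)}(\mathfrak{C})$ if $v\in\mathit{SigSet}$ and $r(v)\ne r(w)\ne T$; otherwise $\mu(v,w)$ is the promise $\wp_{r(v)}(\mathfrak{C},v,r(w),T)$ (both kinds are elements of $M$); 4. $\delta$ takes values in $\{\text{"abort"},(\mathcal{S}_Q(\mathfrak{C}))_{Q\in A}\}$ and is given by the TTP procedure below. $\mathit{SigSet}(\mathcal{P})$ is the set of $v\in\mathit{SigSet}$ having at least one outgoing message edge. For $v\in V\setminus\{v_T\}$: $K(v)=\{(w,v')\in E: \mu(w,v')\in M,\ v'\preceq v,\ r(v')=r(v)\}$ and $K_\prec(v)=\{(w,v')\in K(v): v'\prec v\}$; $K_\prec(S)=\bigcup_{v\in S}K_\prec(v)$. $v\in\mathit{InitSet}(\mathcal{P})$ iff $\{r(w): (w,v')\in K_\prec(v)\}\cup\{r(v)\}\neq A$. $v\in\mathit{EndSet}(\mathcal{P})$ iff $\{r(w): (w,v')\in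 K(v),\ w\in\mathit{SigSet}(\mathcal{P})\}\cup\{r(v)\}=A$. **TTP procedure.** Taking the exit edge $(v,v_T)$ means that signer $r(v)$ sends to $T$ the message $p_v$ consisting of the promise $\wp_{r(v)}(\mathfrak{C},v,r(v),T)$ and the list of labels of all edges in $K_\prec(v)$. $T$ keeps sets $J\subseteq V$, $\mathit{Dishonest}\subseteq A$ (initially empty) and a value $\mathit{decision}$ (initially "abort"). On receiving $p_v$ from $P=r(v)$: (a) if $P\in\mathit{Dishonest}$ or some $w'\in J$ has $r(w')=P$, add $P$ to $\mathit{Dishonest}$ and reply "abort"; (b) otherwise put $J:=J\cup\{v\}$; if $v\notin\mathit{InitSet}(\mathcal{P})$, then first for every $w\in J$ for which there is $(w',x)\in K_\prec(J)$ with $w\prec(w',x)$ and $r(w')=r(w)$, add $r(w)$ to $\mathit{Dishonest}$, and afterwards, if every $w\in J$ with $r(w)\notin\mathit{Dishonest}$ has $r(w)=P$, set $\mathit{decision}:=(\mathcal{S}_Q(\mathfrak{C}))_{Q\in A}$; finally reply $\mathit{decision}$. $\delta(m_1,\dots,m_n)$ is the reply to the last message of the sequence. (Malformed messages are answered by "abort".) **Executions.** A state is a set $s\subseteq V\cup E$; the initial state is $s_0=\emptyset$. Transitions $s\to s'$ with $s\ne s'$ are: ($\mathit{recv}$) $s'=s\cup\{v\}$ with $v\in V$, $\mathrm{in}(v)\subseteq s$; ($\mathit{send}$) $s'=s\cup\{e\}$ with $\mu(e)\in M$; ($\varepsilon$) $s'=s\cup\{e\}$ with $e=(v,v')$, $\mu(e)=\varepsilon$,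 $v\in s$; ($\mathit{exit}$) $s'=s\cup\{e\}$ with $\mu(e)=\mathit{exit}$, $e=(v,v_T)$, where $r(v)$ has executed all receive events causally preceding $v$, i.e. every $v'\prec v$ with $r(v')=r(v)$ lies in $s$. An execution is a finite sequence of states and transition labels $[s_0,\alpha_1,s_1,\dots,\alpha_l,s_l]$ starting in $s_0$ whose consecutive states are related by transitions. It is closed if all its states are causally closed, it contains no exit transition, and it cannot be extended by any non-exit transition. **Optimistic.** $\mathcal{P}$ is optimistic if its execution with all signers honest, without failures and without involvement of $T$, gives every signer all signatures: the final state of every closed execution contains, for each $P\in A$, some $v\in\mathit{EndSet}(\mathcal{P})$ with $r(v)=P$. **Honesty.** For a role $P$ let $E_P$ be the set of edges having an endpoint of role $P$, and $V_P$ the set of endpoints of edges in $E_P$. Signer $P$ is honest in an execution if for every state $s_i$ of it the set $s=s_i\cap(V_P\cup E_P)$ satisfies, with causal closedness taken in the graph $(V_P,E_P)$: (1) $s$ contains at most one exit edge; (2) if $s$ contains no exit edge, $s$ is causally closed; (3) if $s$ contains an exit edge $e=(v,w)$, then $v\notin s$ and $s\setminus\{e\}$ is causally closed. **Fairness of an execution.** An execution with final state $s_n$ is fair for signer $P$ if at least one of the following holds: (i) no reply of $T$ in the execution is a list of signatures, and no message edge $(v,w)\in s_n$ with $r(v)=P$ has $v\in\mathit{SigSet}(\mathcal{P})$; (ii) there is $v\in s_n\cap\mathit{EndSet}(\mathcal{P})$ with $r(v)=P$; (iii) $P$ has not received "abort" from $T$, i.e. for each exit edge $(v,v_T)\in s_n$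 with $r(v)=P$, the reply of $T$ at the moment this edge was executed is not "abort". *)

theory Defs
  imports
    "HOL-Library.Sublist"
    "HOL-Combinatorics.Multiset_Permutations"
begin

section \<open>Causality in directed graphs\<close>

datatype 'v event = Vertex 'v | Edge "'v \<times> 'v"

definition events :: "'v set \<Rightarrow> ('v \<times> 'v) set \<Rightarrow> 'v event set" where
  "events V E = Vertex ` V \<union> Edge ` E"

fun precedes :: "('v \<times> 'v) set \<Rightarrow> 'v event \<Rightarrow> 'v event \<Rightarrow> bool" where
  "precedes E (Vertex v) (Vertex w) \<longleftrightarrow> (v, w) \<in> E\<^sup>+"
| "precedes E (Vertex v) (Edge (v', w')) \<longleftrightarrow> (v, v') \<in> E\<^sup>*"
| "precedes E (Edge (v, w)) (Vertex v') \<longleftrightarrow> (w, v') \<in> E\<^sup>*"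
| "precedes E (Edge (v, w)) (Edge (v', w')) \<longleftrightarrow> (w, v') \<in> E\<^sup>*"

definition causally_closed :: "'v set \<Rightarrow> ('v \<times> 'v) set \<Rightarrow> 'v event set \<Rightarrow> bool" where
  "causally_closed V E S \<longleftrightarrow>
     S \<subseteq> events V E \<and> (\<forall>x\<in>S. \<forall>y\<in>events V E. precedes E y x \<longrightarrow> y \<in> S)"


section \<open>DAG protocol specifications\<close>

text \<open>The set of messages is rendered by the type \<open>'m\<close>; the symbols \<open>Eps\<close> and \<open>Exit\<close> lie
  outside it by construction.\<close>

datatype 'm label = Msg 'm | Eps | Exit

record ('v, 'r, 'm) protocol =
  roles :: "'r set"
  ttp :: 'r
  verts :: "'v set"
  edges :: "('v \<times> 'v) set"
  role :: "'v \<Rightarrow> 'r"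
  label :: "'v \<times> 'v \<Rightarrow> 'm label"
  delta :: "'m list \<Rightarrow> 'm"

definition dag_protocol :: "('v, 'r, 'm) protocol \<Rightarrow> bool" where
  "dag_protocol \<P> \<longleftrightarrow>
     finite (verts \<P>) \<and> edges \<P> \<subseteq> verts \<P> \<times> verts \<P> \<and> acyclic (edges \<P>) \<and>
     ttp \<P> \<notin> roles \<P> \<and>
     (\<forall>v\<in>verts \<P>. role \<P> v \<in> roles \<P> \<union> {ttp \<P>}) \<and>
     (\<forall>(v, w)\<in>edges \<P>.
        (label \<P> (v, w) = Eps \<longrightarrow> role \<P> v = role \<P> w) \<and>
        (label \<P> (v, w) = Exit \<longrightarrow> role \<P> w = ttp \<P>))"

definition msg_edges :: "('v, 'r, 'm) protocol \<Rightarrow> ('v \<times> 'v) set" where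
  "msg_edges \<P> = {e \<in> edges \<P>. \<exists>m. label \<P> e = Msg m}"

definition exit_edges :: "('v, 'r, 'm) protocol \<Rightarrow> ('v \<times> 'v) set" where
  "exit_edges \<P> = {e \<in> edges \<P>. label \<P> e = Exit}"

definition paths :: "('v, 'r, 'm) protocol \<Rightarrow> 'v set \<Rightarrow> 'v \<Rightarrow> 'v list set" where
  "paths \<P> I v = {p. p \<noteq> [] \<and> set p \<subseteq> verts \<P> \<and> hd p \<in> I \<and> last p = v \<and>
                     successively (\<lambda>a b. (a, b) \<in> edges \<P>) p}"

definition role_seqs :: "('v, 'r, 'm) protocol \<Rightarrow> 'v set \<Rightarrow> 'v \<Rightarrow> 'r list set" where
  "role_seqs \<P> I v = map (role \<P>) ` paths \<P> I v"


section \<open>Executions\<close>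

datatype 'v action = Recv 'v | Send "'v \<times> 'v" | Epsilon "'v \<times> 'v" | Take_exit "'v \<times> 'v"

inductive transition ::
  "('v, 'r, 'm) protocol \<Rightarrow> 'v event set \<Rightarrow> 'v action \<Rightarrow> 'v event set \<Rightarrow> bool"
  for \<P> where
  recv: "\<lbrakk>v \<in> verts \<P>; \<forall>e\<in>edges \<P>. snd e = v \<longrightarrow> Edge e \<in> s; s' = s \<union> {Vertex v}; s \<noteq> s'\<rbrakk>
    \<Longrightarrow> transition \<P> s (Recv v) s'"
| send: "\<lbrakk>e \<in> msg_edges \<P>; s' = s \<union> {Edge e}; s \<noteq> s'\<rbrakk>
    \<Longrightarrow> transition \<P> s (Send e) s'"
| epsilon: "\<lbrakk>(v, w) \<in> edges \<P>; label \<P> (v, w) = Eps; Vertex v \<in> s;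
             s' = s \<union> {Edge (v, w)}; s \<noteq> s'\<rbrakk>
    \<Longrightarrow> transition \<P> s (Epsilon (v, w)) s'"
| take_exit: "\<lbrakk>(v, w) \<in> exit_edges \<P>;
             \<forall>u. (u, v) \<in> (edges \<P>)\<^sup>+ \<and> role \<P> u = role \<P> v \<longrightarrow> Vertex u \<in> s;
             s' = s \<union> {Edge (v, w)}; s \<noteq> s'\<rbrakk>
    \<Longrightarrow> transition \<P> s (Take_exit (v, w)) s'"

text \<open>An execution \<open>[s\<^sub>0, \<alpha>\<^sub>1, s\<^sub>1, \<dots>, \<alpha>\<^sub>l, s\<^sub>l]\<close> is given by its states \<open>ss = [s\<^sub>0, \<dots>, s\<^sub>l]\<close>
  and its transition labels \<open>as = [\<alpha>\<^sub>1, \<dots>, \<alpha>\<^sub>l]\<close>.\<close>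

definition execution ::
  "('v, 'r, 'm) protocol \<Rightarrow> 'v event set list \<Rightarrow> 'v action list \<Rightarrow> bool" where
  "execution \<P> ss as \<longleftrightarrow>
     length ss = Suc (length as) \<and> ss ! 0 = {} \<and>
     (\<forall>i<length as. transition \<P> (ss ! i) (as ! i) (ss ! Suc i))"

fun is_exit :: "'v action \<Rightarrow> bool" where
  "is_exit (Take_exit e) = True"
| "is_exit _ = False"

definition closed_execution ::
  "('v, 'r, 'm) protocol \<Rightarrow> 'v event set list \<Rightarrow> 'v action list \<Rightarrow> bool" where
  "closed_execution \<P> ss as \<longleftrightarrow>
     execution \<P> ss as \<and>
     (\<forall>s\<in>set ss. causally_closed (verts \<P>) (edges \<P>) s) \<and>
     (\<forall>a\<in>set as. \<not> is_exit a) \<and>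
     (\<nexists>a s. \<not> is_exit a \<and> transition \<P> (last ss) a s)"

definition role_edges :: "('v, 'r, 'm) protocol \<Rightarrow> 'r \<Rightarrow> ('v \<times> 'v) set" where
  "role_edges \<P> P = {(v, w) \<in> edges \<P>. role \<P> v = P \<or> role \<P> w = P}"

definition role_verts :: "('v, 'r, 'm) protocol \<Rightarrow> 'r \<Rightarrow> 'v set" where
  "role_verts \<P> P = Field (role_edges \<P> P)"

text \<open>\<open>role_verts\<close> also contains the vertices of other roles adjacent to a vertex of \<open>P\<close>;
  causal closedness below is with respect to this subgraph, not the whole graph.\<close>

definition honest_state :: "('v, 'r, 'm) protocol \<Rightarrow> 'r \<Rightarrow> 'v event set \<Rightarrow> bool" where
  "honest_state \<P> P s \<longleftrightarrow>
     (\<forall>e\<in>exit_edges \<P>. \<forall>e'\<in>exit_edges \<P>. Edge e \<in> s \<and> Edge e' \<in> s \<longrightarrow> e = e') \<and>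
     ((\<forall>e\<in>exit_edges \<P>. Edge e \<notin> s) \<longrightarrow>
        causally_closed (role_verts \<P> P) (role_edges \<P> P) s) \<and>
     (\<forall>(v, w)\<in>exit_edges \<P>. Edge (v, w) \<in> s \<longrightarrow>
        Vertex v \<notin> s \<and>
        causally_closed (role_verts \<P> P) (role_edges \<P> P) (s - {Edge (v, w)}))"

definition honest :: "('v, 'r, 'm) protocol \<Rightarrow> 'r \<Rightarrow> 'v event set list \<Rightarrow> bool" where
  "honest \<P> P ss \<longleftrightarrow>
     (\<forall>s\<in>set ss. honest_state \<P> P (s \<inter> events (role_verts \<P> P) (role_edges \<P> P)))"


section \<open>DAG MPCS protocols\<close>

text \<open>Messages are free terms: \<open>Signature P C\<close> is the signature of \<open>P\<close> on \<open>C\<close>, and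
  \<open>Promise P C v Q T\<close> is the promise of \<open>P\<close> to \<open>Q\<close>, made at vertex \<open>v\<close>, to sign \<open>C\<close>, with
  trusted third party \<open>T\<close>. \<open>Other\<close> leaves room for arbitrary further messages.\<close>

datatype ('v, 'r, 'c, 'x) message =
    Signature 'r 'c
  | Promise 'r 'c 'v 'r 'r
  | Abort
  | Tuple "('v, 'r, 'c, 'x) message list"
  | Other 'x

type_synonym ('v, 'r, 'c, 'x) mpcs = "('v, 'r, ('v, 'r, 'c, 'x) message) protocol"

text \<open>Lists indexed by a finite set use a fixed but unspecified enumeration of that set.\<close>

definition enumeration :: "'a set \<Rightarrow> 'a list" where
  "enumeration S = (SOME xs. set xs = S \<and> distinct xs)"

definition all_signatures :: "'r set \<Rightarrow> 'c \<Rightarrow> ('v, 'r, 'c, 'x) message" where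
  "all_signatures A C = Tuple (map (\<lambda>Q. Signature Q C) (enumeration A))"

definition ttp_vertex :: "('v, 'r, 'm) protocol \<Rightarrow> 'v" where
  "ttp_vertex \<P> = (THE v. v \<in> verts \<P> \<and> role \<P> v = ttp \<P>)"

definition sig_vertices :: "('v, 'r, 'm) protocol \<Rightarrow> 'v set \<Rightarrow> 'v set" where
  "sig_vertices \<P> SigSet = {v \<in> SigSet. \<exists>w. (v, w) \<in> msg_edges \<P>}"

definition known :: "('v, 'r, 'm) protocol \<Rightarrow> 'v \<Rightarrow> ('v \<times> 'v) set" where
  "known \<P> v = {(w, v'). (w, v') \<in> msg_edges \<P> \<and> (v', v) \<in> (edges \<P>)\<^sup>* \<and> role \<P> v' = role \<P> v}"

definition known_before :: "('v, 'r, 'm) protocol \<Rightarrow> 'v \<Rightarrow> ('v \<times> 'v) set" where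
  "known_before \<P> v = {(w, v') \<in> known \<P> v. (v', v) \<in> (edges \<P>)\<^sup>+}"

definition init_set :: "('v, 'r, 'm) protocol \<Rightarrow> 'r set \<Rightarrow> 'v set" where
  "init_set \<P> A = {v \<in> verts \<P> - {ttp_vertex \<P>}.
     {role \<P> w |w v'. (w, v') \<in> known_before \<P> v} \<union> {role \<P> v} \<noteq> A}"

definition end_set :: "('v, 'r, 'm) protocol \<Rightarrow> 'r set \<Rightarrow> 'v set \<Rightarrow> 'v set" where
  "end_set \<P> A SigSet = {v \<in> verts \<P> - {ttp_vertex \<P>}.
     {role \<P> w |w v'. (w, v') \<in> known \<P> v \<and> w \<in> sig_vertices \<P> SigSet} \<union> {role \<P> v} = A}"


subsection \<open>The trusted third party\<close>

definition exit_message ::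
  "('v, 'r, 'c, 'x) mpcs \<Rightarrow> 'c \<Rightarrow> 'v \<Rightarrow> ('v, 'r, 'c, 'x) message" where
  "exit_message \<P> C v = Tuple
     [Promise (role \<P> v) C v (role \<P> v) (ttp \<P>),
      Tuple (map (\<lambda>e. THE m. label \<P> e = Msg m) (enumeration (known_before \<P> v)))]"

record ('v, 'r, 'm) ttp_state =
  evidence :: "'v set"
  dishonest :: "'r set"
  decision :: 'm

definition ttp_init :: "('v, 'r, ('v, 'r, 'c, 'x) message) ttp_state" where
  "ttp_init = \<lparr>evidence = {}, dishonest = {}, decision = Abort\<rparr>"

text \<open>The new state of the TTP and its reply upon receiving the exit message of \<open>v\<close>.\<close>

definition ttp_handle ::
  "('v, 'r, 'c, 'x) mpcs \<Rightarrow> 'c \<Rightarrow> 'r set \<Rightarrow> ('v, 'r, ('v, 'r, 'c, 'x) message) ttp_state \<Rightarrow> 'v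
    \<Rightarrow> ('v, 'r, ('v, 'r, 'c, 'x) message) ttp_state \<times> ('v, 'r, 'c, 'x) message" where
  "ttp_handle \<P> C A \<sigma> v =
     (let P = role \<P> v; J = evidence \<sigma>; D = dishonest \<sigma> in
      if P \<in> D \<or> (\<exists>w'\<in>J. role \<P> w' = P)
      then (\<sigma>\<lparr>dishonest := D \<union> {P}\<rparr>, Abort)
      else let J' = J \<union> {v} in
        if v \<in> init_set \<P> A
        then (\<sigma>\<lparr>evidence := J'\<rparr>, decision \<sigma>)
        else
          let D' = D \<union> {role \<P> w |w. w \<in> J' \<and>
                 (\<exists>(w', x)\<in>(\<Union>u\<in>J'. known_before \<P> u).
                    precedes (edges \<P>) (Vertex w) (Edge (w', x)) \<and> role \<P> w' = role \<P> w)};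
              d' = (if \<forall>w\<in>J'. role \<P> w \<notin> D' \<longrightarrow> role \<P> w = P
                    then all_signatures A C else decision \<sigma>)
          in (\<lparr>evidence = J', dishonest = D', decision = d'\<rparr>, d'))"

definition ttp_step ::
  "('v, 'r, 'c, 'x) mpcs \<Rightarrow> 'c \<Rightarrow> 'r set \<Rightarrow> ('v, 'r, ('v, 'r, 'c, 'x) message) ttp_state
    \<Rightarrow> ('v, 'r, 'c, 'x) message
    \<Rightarrow> ('v, 'r, ('v, 'r, 'c, 'x) message) ttp_state \<times> ('v, 'r, 'c, 'x) message" where
  "ttp_step \<P> C A \<sigma> m =
     (if \<exists>v\<in>verts \<P> - {ttp_vertex \<P>}. m = exit_message \<P> C v
      then ttp_handle \<P> C A \<sigma> (THE v. v \<in> verts \<P> - {ttp_vertex \<P>} \<and> m = exit_message \<P> C v)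
      else (\<sigma>, Abort))"

text \<open>The reply to the last message of a nonempty sequence.\<close>

definition ttp_reply ::
  "('v, 'r, 'c, 'x) mpcs \<Rightarrow> 'c \<Rightarrow> 'r set \<Rightarrow> ('v, 'r, 'c, 'x) message list
    \<Rightarrow> ('v, 'r, 'c, 'x) message" where
  "ttp_reply \<P> C A ms =
     snd (ttp_step \<P> C A (foldl (\<lambda>\<sigma> m. fst (ttp_step \<P> C A \<sigma> m)) ttp_init (butlast ms)) (last ms))"


subsection \<open>The protocol class and its properties\<close>

definition mpcs_protocol ::
  "('v, 'r, 'c, 'x) mpcs \<Rightarrow> 'c \<Rightarrow> 'r set \<Rightarrow> 'v set \<Rightarrow> bool" where
  "mpcs_protocol \<P> C A SigSet \<longleftrightarrow>
     dag_protocol \<P> \<and> finite A \<and> A \<subseteq> roles \<P> \<and> SigSet \<subseteq> verts \<P> \<and>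
     (\<exists>!v. v \<in> verts \<P> \<and> role \<P> v = ttp \<P>) \<and>
     (\<forall>v\<in>verts \<P> - {ttp_vertex \<P>}. (v, ttp_vertex \<P>) \<in> edges \<P> \<and> role \<P> v \<in> A) \<and>
     (\<forall>v\<in>verts \<P>. \<forall>w\<in>verts \<P>. (v, w) \<in> (edges \<P>)\<^sup>+ \<longrightarrow>
        (v, w) \<in> edges \<P> \<or>
        (\<exists>u\<in>verts \<P>. (v, u) \<in> (edges \<P>)\<^sup>+ \<and> (u, w) \<in> (edges \<P>)\<^sup>+ \<and>
           role \<P> u \<in> {role \<P> v, role \<P> w})) \<and>
     (\<forall>(v, w)\<in>edges \<P>. label \<P> (v, w) =
        (if role \<P> v = role \<P> w then Eps
         else if w = ttp_vertex \<P> then Exit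
         else if v \<in> SigSet then Msg (Signature (role \<P> v) C)
         else Msg (Promise (role \<P> v) C v (role \<P> w) (ttp \<P>)))) \<and>
     (\<forall>ms. delta \<P> ms \<in> {Abort, all_signatures A C}) \<and>
     (\<forall>ms. ms \<noteq> [] \<longrightarrow> delta \<P> ms = ttp_reply \<P> C A ms)"

definition optimistic :: "('v, 'r, 'm) protocol \<Rightarrow> 'r set \<Rightarrow> 'v set \<Rightarrow> bool" where
  "optimistic \<P> A SigSet \<longleftrightarrow>
     (\<forall>ss as. closed_execution \<P> ss as \<longrightarrow>
        (\<forall>P\<in>A. \<exists>v\<in>end_set \<P> A SigSet. Vertex v \<in> last ss \<and> role \<P> v = P))"

definition no_in_role_parallelism :: "('v, 'r, 'm) protocol \<Rightarrow> 'r set \<Rightarrow> bool" where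
  "no_in_role_parallelism \<P> A \<longleftrightarrow>
     (\<forall>P\<in>A. \<forall>v\<in>verts \<P>. \<forall>w\<in>verts \<P>. role \<P> v = P \<and> role \<P> w = P \<longrightarrow>
        (v, w) \<in> (edges \<P>)\<^sup>* \<or> (w, v) \<in> (edges \<P>)\<^sup>*)"

definition last_init_set :: "('v, 'r, 'm) protocol \<Rightarrow> 'r set \<Rightarrow> 'v set" where
  "last_init_set \<P> A = {v \<in> init_set \<P> A.
     \<forall>w. (v, w) \<in> (edges \<P>)\<^sup>+ \<and> role \<P> v = role \<P> w \<longrightarrow> w \<notin> init_set \<P> A}"

definition contains_all_permutations ::
  "('v, 'r, 'm) protocol \<Rightarrow> 'v set \<Rightarrow> 'v \<Rightarrow> 'r set \<Rightarrow> bool" where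
  "contains_all_permutations \<P> I v B \<longleftrightarrow>
     (\<forall>xs\<in>permutations_of_set B. \<exists>ys\<in>role_seqs \<P> I v. subseq xs ys)"

text \<open>For \<open>i < length as\<close> such that \<open>as ! i\<close> is an exit transition, \<open>reply_at \<P> C as i\<close> is the
  reply of the TTP to the exit message sent in that transition: the sequence of messages the TTP
  has received by then consists of the exit messages of all exit transitions up to index \<open>i\<close>.\<close>

fun sent_to_ttp ::
  "('v, 'r, 'c, 'x) mpcs \<Rightarrow> 'c \<Rightarrow> 'v action list \<Rightarrow> ('v, 'r, 'c, 'x) message list" where
  "sent_to_ttp \<P> C [] = []"
| "sent_to_ttp \<P> C (Take_exit (v, w) # as) = exit_message \<P> C v # sent_to_ttp \<P> C as"
| "sent_to_ttp \<P> C (_ # as) = sent_to_ttp \<P> C as"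

definition reply_at ::
  "('v, 'r, 'c, 'x) mpcs \<Rightarrow> 'c \<Rightarrow> 'v action list \<Rightarrow> nat \<Rightarrow> ('v, 'r, 'c, 'x) message" where
  "reply_at \<P> C as i = delta \<P> (sent_to_ttp \<P> C (take (Suc i) as))"

definition fair_execution ::
  "('v, 'r, 'c, 'x) mpcs \<Rightarrow> 'c \<Rightarrow> 'r set \<Rightarrow> 'v set \<Rightarrow> 'r \<Rightarrow> 'v event set list \<Rightarrow> 'v action list
    \<Rightarrow> bool" where
  "fair_execution \<P> C A SigSet P ss as \<longleftrightarrow>
     (\<not> (\<exists>i<length as. is_exit (as ! i) \<and> reply_at \<P> C as i = all_signatures A C) \<and>
      \<not> (\<exists>(v, w)\<in>msg_edges \<P>. Edge (v, w) \<in> last ss \<and> role \<P> v = P \<and>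
           v \<in> sig_vertices \<P> SigSet)) \<or>
     (\<exists>v\<in>end_set \<P> A SigSet. Vertex v \<in> last ss \<and> role \<P> v = P) \<or>
     (\<forall>v w. (v, w) \<in> exit_edges \<P> \<and> Edge (v, w) \<in> last ss \<and> role \<P> v = P \<longrightarrow>
        (\<forall>i<length as. as ! i = Take_exit (v, w) \<longrightarrow> reply_at \<P> C as i \<noteq> Abort))"

definition fair_for ::
  "('v, 'r, 'c, 'x) mpcs \<Rightarrow> 'c \<Rightarrow> 'r set \<Rightarrow> 'v set \<Rightarrow> 'r \<Rightarrow> bool" where
  "fair_for \<P> C A SigSet P \<longleftrightarrow>
     (\<forall>ss as. execution \<P> ss as \<and> honest \<P> P ss \<longrightarrow> fair_execution \<P> C A SigSet P ss as)"

end

theory Submission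
  imports Defs
begin

text \<open>Suppose the honest signer \<open>P\<close> exits at \<open>v\<close> after sending a signature at \<open>z\<close>, and the TTP
  answers "abort". Since \<open>P\<close> sends nothing after \<open>v\<close>, it is never declared dishonest and its
  evidence blocks every later decision to issue signatures. A reply "abort" is justified by a
  chain of exits \<open>v = w\<^sub>0, w\<^sub>1, \<dots>, w\<^sub>m\<close> by different signers, where \<open>w\<^sub>m\<close> is in the initial set and the
  exit message of \<open>w\<^sub>j\<close> does not prove that the signer of \<open>w\<^sub>j\<^sub>+\<^sub>1\<close> went on after \<open>w\<^sub>j\<^sub>+\<^sub>1\<close>. Some path from
  \<open>I\<close> to \<open>z\<close> visits the signers of \<open>w\<^sub>m, \<dots>, w\<^sub>1\<close> in this order, say at \<open>q\<^sub>m, \<dots>, q\<^sub>1\<close>. Going backwards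
  from \<open>z \<prec> v\<close>, the message that signer \<open>j + 1\<close> must send between \<open>q\<^sub>j\<^sub>+\<^sub>1\<close> and \<open>q\<^sub>j\<close> shows
  \<open>q\<^sub>j\<^sub>+\<^sub>1 \<prec> w\<^sub>j\<^sub>+\<^sub>1\<close>. Hence \<open>w\<^sub>m\<close> lies after a vertex of \<open>I\<close>, by which time everybody's promises are
  known, contradicting that \<open>w\<^sub>m\<close> is in the initial set.\<close>

section \<open>Subsequences and chains of edges\<close>

lemma subseq_snocE:
  assumes "subseq (xs @ [x]) ys"
  obtains ys1 ys2 where "ys = ys1 @ x # ys2" "subseq xs ys1"
proof -
  obtain us vs where "ys = us @ vs" "subseq xs us" "subseq [x] vs"
    using list_emb_appendD[OF assms] by blast
  moreover from \<open>subseq [x] vs\<close> obtain vs1 vs2 where "vs = vs1 @ x # vs2"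
    using list_emb_ConsD[OF \<open>subseq [x] vs\<close>] by blast
  ultimately show thesis
    using that[of "us @ vs1" vs2] by (simp add: list_emb_prefix)
qed

lemma successively_rtrancl:
  assumes "successively (\<lambda>a b. (a, b) \<in> R) (x # xs)" "y \<in> set (x # xs)"
  shows "(x, y) \<in> R\<^sup>*"
  using assms
proof (induction xs arbitrary: x)
  case (Cons a xs)
  then show ?case by (auto intro: converse_rtrancl_into_rtrancl)
qed auto

section \<open>Growth of states along executions\<close>

lemma transition_mono: "transition \<P> s a s' \<Longrightarrow> s \<subseteq> s'"
  by (auto elim: transition.cases)

lemma execution_mono:
  assumes "execution \<P> ss as" "i \<le> j" "j \<le> length as"
  shows "ss ! i \<subseteq> ss ! j"
  using assms(2,3)
proof (induction j rule: dec_induct)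
  case (step n)
  then have "transition \<P> (ss ! n) (as ! n) (ss ! Suc n)"
    using assms(1) by (auto simp: execution_def)
  with step show ?case by (auto dest: transition_mono)
qed auto

lemma execution_last:
  assumes "execution \<P> ss as"
  shows "last ss = ss ! length as"
  using assms by (metis execution_def diff_Suc_1 last_conv_nth length_0_conv nat.distinct(1))

lemma execution_subset_last:
  assumes "execution \<P> ss as" "i \<le> length as"
  shows "ss ! i \<subseteq> last ss"
  using execution_mono[OF assms] assms(1) by (simp add: execution_last)

text \<open>Only a receive step adds a vertex, and it demands all incoming edges, while states never
  shrink. So messages received by a dishonest signer were really sent.\<close>

lemma execution_incoming:
  assumes "execution \<P> ss as" "i \<le> length as" "Vertex x \<in> ss ! i" "(w, x) \<in> edges \<P>"
  shows "Edge (w, x) \<in> ss ! i"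
  using assms(2,3)
proof (induction i)
  case 0
  then show ?case using assms(1) by (auto simp: execution_def)
next
  case (Suc i)
  then have "transition \<P> (ss ! i) (as ! i) (ss ! Suc i)"
    using assms(1) by (auto simp: execution_def)
  then show ?case
    using Suc assms(4) by cases auto
qed

lemma execution_snoc:
  assumes "execution \<P> ss as" "transition \<P> (last ss) a s'"
  shows "execution \<P> (ss @ [s']) (as @ [a])"
proof -
  have len: "length ss = Suc (length as)"
    using assms(1) by (simp add: execution_def)
  then have "ss \<noteq> []" by auto
  with assms len show ?thesis
    unfolding execution_last[OF assms(1)]
    by (auto simp: execution_def nth_append less_Suc_eq)
qed

lemma execution_exit_edge:
  assumes "execution \<P> ss as" "i < length as" "as ! i = Take_exit e"
  shows "e \<in> exit_edges \<P>" "Edge e \<notin> ss ! i" "Edge e \<in> ss ! Suc i"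
    "\<And>u. (u, fst e) \<in> (edges \<P>)\<^sup>+ \<Longrightarrow> role \<P> u = role \<P> (fst e) \<Longrightarrow> Vertex u \<in> ss ! i"
proof -
  have "transition \<P> (ss ! i) (Take_exit e) (ss ! Suc i)"
    using assms by (auto simp: execution_def)
  then have "e \<in> exit_edges \<P> \<and> Edge e \<notin> ss ! i \<and> Edge e \<in> ss ! Suc i \<and>
    (\<forall>u. (u, fst e) \<in> (edges \<P>)\<^sup>+ \<and> role \<P> u = role \<P> (fst e) \<longrightarrow> Vertex u \<in> ss ! i)"
  proof cases
    case (take_exit v w)
    from take_exit(4,5) have "Edge (v, w) \<notin> ss ! i" by blast
    with take_exit show ?thesis by simp
  qed
  then show "e \<in> exit_edges \<P>" "Edge e \<notin> ss ! i" "Edge e \<in> ss ! Suc i"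
    "\<And>u. (u, fst e) \<in> (edges \<P>)\<^sup>+ \<Longrightarrow> role \<P> u = role \<P> (fst e) \<Longrightarrow> Vertex u \<in> ss ! i"
    by simp_all
qed

text \<open>Transitions enlarge the state strictly, so an exit edge that is already present cannot
  be taken again.\<close>

lemma execution_exit_once:
  assumes "execution \<P> ss as" "i < length as" "j < length as"
    "as ! i = Take_exit e" "as ! j = Take_exit e"
  shows "i = j"
proof -
  have False if "k < l" "l < length as" "as ! k = Take_exit e" "as ! l = Take_exit e" for k l
  proof -
    have "Edge e \<in> ss ! Suc k"
      using execution_exit_edge(3)[OF assms(1) _ that(3)] that by auto
    moreover have "ss ! Suc k \<subseteq> ss ! l"
      using execution_mono[OF assms(1)] that by auto
    ultimately show False
      using execution_exit_edge(2)[OF assms(1) that(2,4)] by auto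
  qed
  with assms show ?thesis by (cases i j rule: linorder_cases) auto
qed

section \<open>The sequence of exiting vertices\<close>

fun exits :: "'v action list \<Rightarrow> 'v list" where
  "exits [] = []"
| "exits (Take_exit (v, w) # as) = v # exits as"
| "exits (_ # as) = exits as"

lemma exits_append: "exits (as @ bs) = exits as @ exits bs"
  by (induction as rule: exits.induct) auto

lemma sent_to_ttp_eq: "sent_to_ttp \<P> C as = map (exit_message \<P> C) (exits as)"
  by (induction as rule: exits.induct) auto

lemma in_exits_iff: "v \<in> set (exits as) \<longleftrightarrow> (\<exists>w. Take_exit (v, w) \<in> set as)"
  by (induction as rule: exits.induct) auto

text \<open>The promise in the first component carries the vertex, so the \<open>THE\<close> in
  \<open>ttp_step\<close> recovers the exiting vertex.\<close>

lemma exit_message_inject [simp]: "exit_message \<P> C v = exit_message \<P> C w \<longleftrightarrow> v = w"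
  by (auto simp: exit_message_def)

lemma all_signatures_neq_Abort [simp]: "all_signatures A C \<noteq> Abort"
  by (simp add: all_signatures_def)

section \<open>Causality in MPCS protocols\<close>

locale mpcs =
  fixes \<P> :: "('v, 'r, 'c, 'x) mpcs" and C :: 'c and A :: "'r set" and SigSet :: "'v set"
  assumes protocol: "mpcs_protocol \<P> C A SigSet"
begin

abbreviation "V \<equiv> verts \<P>"
abbreviation "E \<equiv> edges \<P>"
abbreviation "T \<equiv> ttp_vertex \<P>"
abbreviation "r \<equiv> role \<P>"

lemma dag: "dag_protocol \<P>"
  and finite_signers: "finite A"
  and ex1_ttp_vertex: "\<exists>!v. v \<in> V \<and> r v = ttp \<P>"
  and exit_and_signer: "\<forall>v\<in>V - {T}. (v, T) \<in> E \<and> r v \<in> A"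
  and interpolation_cond: "\<forall>v\<in>V. \<forall>w\<in>V. (v, w) \<in> E\<^sup>+ \<longrightarrow> (v, w) \<in> E \<or>
        (\<exists>u\<in>V. (v, u) \<in> E\<^sup>+ \<and> (u, w) \<in> E\<^sup>+ \<and> r u \<in> {r v, r w})"
  and labels: "\<forall>(v, w)\<in>E. label \<P> (v, w) =
        (if r v = r w then Eps
         else if w = T then Exit
         else if v \<in> SigSet then Msg (Signature (r v) C)
         else Msg (Promise (r v) C v (r w) (ttp \<P>)))"
  and delta_eq: "\<forall>ms. ms \<noteq> [] \<longrightarrow> delta \<P> ms = ttp_reply \<P> C A ms"
  using protocol unfolding mpcs_protocol_def by - (elim conjE, assumption)+

lemma finite_verts: "finite V"
  and edges_subset: "E \<subseteq> V \<times> V"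
  and acyclic_edges: "acyclic E"
  using dag unfolding dag_protocol_def by - (elim conjE, assumption)+

lemma finite_edges: "finite E"
  using finite_verts edges_subset by (meson finite_SigmaI finite_subset)

lemma trancl_verts: "(v, w) \<in> E\<^sup>+ \<Longrightarrow> v \<in> V \<and> w \<in> V"
  using edges_subset by (metis mem_Sigma_iff subsetD trancl_subset_Sigma)

lemma irrefl_trancl: "(v, v) \<notin> E\<^sup>+"
  using acyclic_edges by (auto simp: acyclic_def)

lemma role_ttp_iff: "v \<in> V \<Longrightarrow> r v = ttp \<P> \<longleftrightarrow> v = T"
  and ttp_vertex_in_verts: "T \<in> V"
proof -
  from theI'[OF ex1_ttp_vertex] have "T \<in> V" "r T = ttp \<P>"
    by (auto simp: ttp_vertex_def)
  with ex1_ttp_vertex show "v \<in> V \<Longrightarrow> r v = ttp \<P> \<longleftrightarrow> v = T" "T \<in> V" by auto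
qed

lemma signer_in: "v \<in> V \<Longrightarrow> v \<noteq> T \<Longrightarrow> r v \<in> A"
  and edge_to_ttp: "v \<in> V \<Longrightarrow> v \<noteq> T \<Longrightarrow> (v, T) \<in> E"
  using exit_and_signer by auto

lemma no_edge_from_ttp: "(T, w) \<notin> E"
proof
  assume e: "(T, w) \<in> E"
  then have "w \<in> V" using edges_subset by auto
  then have "(w, T) \<in> E\<^sup>*" using edge_to_ttp[of w] by (cases "w = T") auto
  with e have "(T, T) \<in> E\<^sup>+" by (rule rtrancl_into_trancl2)
  then show False using irrefl_trancl by simp
qed

lemma source_signer: "(v, w) \<in> E \<Longrightarrow> v \<in> V \<and> v \<noteq> T \<and> r v \<in> A"
  using no_edge_from_ttp[of w] signer_in[of v] edges_subset by auto

lemma label_edge: "(v, w) \<in> E \<Longrightarrow> label \<P> (v, w) =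
        (if r v = r w then Eps
         else if w = T then Exit
         else if v \<in> SigSet then Msg (Signature (r v) C)
         else Msg (Promise (r v) C v (r w) (ttp \<P>)))"
  using labels by auto

lemma msg_edges_iff: "(v, w) \<in> msg_edges \<P> \<longleftrightarrow> (v, w) \<in> E \<and> r v \<noteq> r w \<and> w \<noteq> T"
  using label_edge[of v w]
  by (cases "r v = r w"; cases "w = T") (auto simp: msg_edges_def)

lemma exit_edges_iff: "(v, w) \<in> exit_edges \<P> \<longleftrightarrow> v \<in> V \<and> v \<noteq> T \<and> w = T"
proof
  assume "(v, w) \<in> exit_edges \<P>"
  then show "v \<in> V \<and> v \<noteq> T \<and> w = T"
    using label_edge[of v w] source_signer[of v w]
    by (auto simp: exit_edges_def split: if_splits)
next
  assume "v \<in> V \<and> v \<noteq> T \<and> w = T"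
  then show "(v, w) \<in> exit_edges \<P>"
    using edge_to_ttp[of v] label_edge[of v w] role_ttp_iff[of v] role_ttp_iff[of T]
      ttp_vertex_in_verts
    by (auto simp: exit_edges_def)
qed

lemma interpolation:
  assumes "(v, w) \<in> E\<^sup>+"
  shows "(v, w) \<in> E \<or> (\<exists>u. (v, u) \<in> E\<^sup>+ \<and> (u, w) \<in> E\<^sup>+ \<and> r u \<in> {r v, r w})"
  using interpolation_cond assms trancl_verts[OF assms] by meson

section \<open>Refining causality by the interpolation condition\<close>

abbreviation between :: "'v \<Rightarrow> 'v \<Rightarrow> 'v set" where
  "between v w \<equiv> {x. (v, x) \<in> E\<^sup>+ \<and> (x, w) \<in> E\<^sup>+}"

lemma card_between_less:
  assumes "u \<in> between v w"
  shows "card (between v u) < card (between v w)" "card (between u w) < card (between v w)"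
proof -
  have fin: "finite (between v w)"
    using finite_verts trancl_verts by (rule_tac finite_subset[of _ V]) auto
  have "between v u \<subset> between v w" "between u w \<subset> between v w"
    using assms irrefl_trancl[of u] by (auto intro: trancl_trans)
  then show "card (between v u) < card (between v w)" "card (between u w) < card (between v w)"
    using fin by (auto intro: psubset_card_mono)
qed

text \<open>The interpolation condition replaces one endpoint by a closer vertex of the same role.
  Repeating this ends at a direct edge, which carries a message because the roles differ and its
  target is not \<open>T\<close>.\<close>

lemma message_between:
  assumes "(q, z) \<in> E\<^sup>+" "r q \<noteq> r z" "z \<noteq> T"
  shows "\<exists>q' z'. (q', z') \<in> msg_edges \<P> \<and> (q, q') \<in> E\<^sup>* \<and> r q' = r q \<and>
           (z', z) \<in> E\<^sup>* \<and> r z' = r z"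
  using assms
proof (induction "card (between q z)" arbitrary: q z rule: less_induct)
  case less
  from interpolation[OF less.prems(1)] show ?case
  proof (elim disjE exE conjE)
    assume "(q, z) \<in> E"
    then show ?thesis using less.prems by (auto simp: msg_edges_iff)
  next
    fix u assume u: "(q, u) \<in> E\<^sup>+" "(u, z) \<in> E\<^sup>+" "r u \<in> {r q, r z}"
    have "r z \<noteq> ttp \<P>" "u \<in> V"
      using less.prems role_ttp_iff trancl_verts u by blast+
    show ?thesis
    proof (cases "r u = r q")
      case True
      then obtain q' z' where "(q', z') \<in> msg_edges \<P>" "(u, q') \<in> E\<^sup>*" "r q' = r u"
          "(z', z) \<in> E\<^sup>*" "r z' = r z"
        using less.hyps[of u z] card_between_less(2)[of u q z] u less.prems by auto
      then show ?thesis
        using True rtrancl_trans[OF trancl_into_rtrancl[OF u(1)]] by metis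
    next
      case False
      then have "r u = r z" using u by auto
      moreover have "u \<noteq> T"
        using \<open>r u = r z\<close> \<open>r z \<noteq> ttp \<P>\<close> \<open>u \<in> V\<close> role_ttp_iff by metis
      ultimately obtain q' z' where "(q', z') \<in> msg_edges \<P>" "(q, q') \<in> E\<^sup>*" "r q' = r q"
          "(z', u) \<in> E\<^sup>*" "r z' = r u"
        using less.hyps[of q u] card_between_less(1)[of u q z] u less.prems by auto
      then show ?thesis
        using \<open>r u = r z\<close> rtrancl_trans[OF _ trancl_into_rtrancl[OF u(2)]] by metis
    qed
  qed
qed

text \<open>Between endpoints of role \<open>p\<close>, interpolation inserts only vertices of role
  \<open>p\<close>, so the refinement ends in a chain of \<open>p\<close>-edges. This transfers
  causality to the subgraph in which honesty measures causal closedness.\<close>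

lemma same_role_path:
  assumes "(v, w) \<in> E\<^sup>*" "r v = p" "r w = p"
  shows "(v, w) \<in> (role_edges \<P> p)\<^sup>*"
proof (cases "v = w")
  case False
  then have "(v, w) \<in> E\<^sup>+" using assms(1) by (metis rtranclD)
  then show ?thesis using assms(2,3)
  proof (induction "card (between v w)" arbitrary: v w rule: less_induct)
    case less
    from interpolation[OF less.prems(1)] show ?case
    proof (elim disjE exE conjE)
      assume "(v, w) \<in> E"
      then show ?thesis using less.prems by (auto simp: role_edges_def)
    next
      fix u assume u: "(v, u) \<in> E\<^sup>+" "(u, w) \<in> E\<^sup>+" "r u \<in> {r v, r w}"
      then have "(v, u) \<in> (role_edges \<P> p)\<^sup>*" "(u, w) \<in> (role_edges \<P> p)\<^sup>*"
        using less.hyps card_between_less[of u v w] less.prems by auto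
      then show ?thesis by (rule rtrancl_trans)
    qed
  qed
qed auto

text \<open>A message from the role of \<open>q\<close> arrives at or before \<open>y\<close>; since
  \<open>y\<close> has the role of \<open>a\<close> and lies strictly before it, the exit message of
  \<open>a\<close> reports it.\<close>

lemma known_before_message:
  assumes "(q, y) \<in> E\<^sup>+" "(y, a) \<in> E\<^sup>+" "r q \<noteq> r y" "r y = r a" "y \<noteq> T"
  obtains q' x where "(q', x) \<in> known_before \<P> a" "(q, q') \<in> E\<^sup>*" "r q' = r q"
proof -
  obtain q' x where q': "(q', x) \<in> msg_edges \<P>" "(q, q') \<in> E\<^sup>*" "r q' = r q"
    "(x, y) \<in> E\<^sup>*" "r x = r y"
    using message_between[of q y] assms by blast
  have "(x, a) \<in> E\<^sup>+" using q'(4) assms(2) by (rule rtrancl_trancl_trancl)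
  then have "(q', x) \<in> known_before \<P> a"
    using q' assms(4) by (auto simp: known_before_def known_def)
  with q' that show thesis by blast
qed

text \<open>Every source of an edge is a signer's vertex, so the set compared with \<open>A\<close>
  in \<open>init_set\<close> can differ from it only by missing a signer.\<close>

lemma init_set_iff:
  assumes "v \<in> V" "v \<noteq> T"
  shows "v \<in> init_set \<P> A \<longleftrightarrow>
           (\<exists>S\<in>A. S \<noteq> r v \<and> \<not> (\<exists>w x. (w, x) \<in> known_before \<P> v \<and> r w = S))"
proof -
  let ?K = "{r w |w v'. (w, v') \<in> known_before \<P> v}"
  have "?K \<subseteq> A"
    using source_signer by (auto simp: known_before_def known_def msg_edges_def)
  then have "?K \<union> {r v} \<noteq> A \<longleftrightarrow> (\<exists>S\<in>A. S \<noteq> r v \<and> S \<notin> ?K)"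
    using signer_in[OF assms] by blast
  moreover have "v \<in> init_set \<P> A \<longleftrightarrow> ?K \<union> {r v} \<noteq> A"
    using assms by (simp add: init_set_def)
  ultimately show ?thesis by blast
qed


section \<open>Closed executions\<close>

lemma precedes_trans:
  assumes "precedes E x y" "precedes E y z" "y \<in> events V E"
  shows "precedes E x z"
proof -
  show ?thesis
  proof (cases y)
    case (Vertex v)
    show ?thesis
    proof (cases x)
      case x: (Vertex u)
      then show ?thesis
        using assms(1,2) Vertex
        by (cases z) (auto intro: trancl_trans trancl_into_rtrancl rtrancl_trans)
    next
      case x: (Edge e)
      then show ?thesis
        using assms(1,2) Vertex
        by (cases z; cases e) (auto intro: rtrancl_trans trancl_into_rtrancl)
    qed
  next
    case (Edge e)
    obtain v w where e: "e = (v, w)" "(v, w) \<in> E"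
      using assms(3) Edge by (cases e) (auto simp: events_def)
    have *: "(u, u') \<in> E\<^sup>+" if "(u, v) \<in> E\<^sup>*" "(w, u') \<in> E\<^sup>*" for u u'
      using rtrancl_into_trancl1[OF that(1) e(2)] that(2) by (rule trancl_rtrancl_trancl)
    show ?thesis
    proof (cases x)
      case x: (Vertex u)
      then show ?thesis
        using assms(1,2) Edge e(1) *
        by (cases z) (auto simp: trancl_into_rtrancl)
    next
      case x: (Edge e')
      then show ?thesis
        using assms(1,2) Edge e(1) *
        by (cases z; cases e') (auto simp: trancl_into_rtrancl)
    qed
  qed
qed

text \<open>A numerical topological order; the factor 2 leaves room for an edge strictly between its
  source and its target.\<close>

fun rank :: "'v event \<Rightarrow> nat" where
  "rank (Vertex v) = 2 * card {u. (u, v) \<in> E\<^sup>+}"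
| "rank (Edge (v, w)) = Suc (2 * card {u. (u, v) \<in> E\<^sup>+})"

lemma rank_less:
  assumes "precedes E x y" "x \<in> events V E"
  shows "rank x < rank y"
proof -
  have fin: "finite {u. (u, v) \<in> E\<^sup>+}" for v
    using finite_verts trancl_verts by (rule_tac finite_subset[of _ V]) auto
  have less: "card {u. (u, v) \<in> E\<^sup>+} < card {u. (u, w) \<in> E\<^sup>+}" if "(v, w) \<in> E\<^sup>+" for v w
    using that irrefl_trancl[of v] by (intro psubset_card_mono fin) (auto intro: trancl_trans)
  then have le: "card {u. (u, v) \<in> E\<^sup>+} \<le> card {u. (u, w) \<in> E\<^sup>+}" if "(v, w) \<in> E\<^sup>*" for v w
    using that by (metis less_imp_le order_refl rtranclD)
  have less2: "card {u. (u, v) \<in> E\<^sup>+} < card {u. (u, w) \<in> E\<^sup>+}"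
    if "(v, x) \<in> E" "(x, w) \<in> E\<^sup>*" for v x w
    using that by (intro less) (rule rtrancl_into_trancl2)
  show ?thesis
    using assms
    by (cases "(E, x, y)" rule: precedes.cases)
      (auto simp: events_def less le_imp_less_Suc le dest: less2)
qed

text \<open>A send step can occur before its source is received, so the given transition may itself
  destroy closedness. It only witnesses that some event can be added without exits; such an event of
  least \<open>rank\<close> has all its predecessors in \<open>s\<close>.\<close>

lemma closed_extension:
  assumes closed: "causally_closed V E s" and trans: "transition \<P> s a s'" "\<not> is_exit a"
  obtains b t where "\<not> is_exit b" "transition \<P> s b t" "causally_closed V E t" "s \<subset> t"
proof -
  \<comment> \<open>The missing events that wait for no missing exit edge. Missing predecessors of
    such an event are again of this kind.\<close>
  define addable where "addable x \<longleftrightarrow>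
      x \<in> events V E \<and> x \<notin> s \<and> (\<forall>e\<in>exit_edges \<P>. x \<noteq> Edge e) \<and>
      (\<forall>e\<in>exit_edges \<P>. precedes E (Edge e) x \<longrightarrow> Edge e \<in> s)" for x
  have to_ttp: "v = T" if "(T, v) \<in> E\<^sup>*" for v
    using that no_edge_from_ttp by (auto elim: converse_rtranclE)
  have not_after_exit: "\<not> precedes E (Edge e) (Edge (v, w))"
    if "e \<in> exit_edges \<P>" "(v, w) \<in> E" for e v w
    using that no_edge_from_ttp to_ttp by (cases e) (auto simp: exit_edges_iff)
  have "\<exists>x. addable x"
    using trans(1)
  proof cases
    case (recv v)
    have "Edge e \<in> s" if "e \<in> exit_edges \<P>" "precedes E (Edge e) (Vertex v)" for e
    proof -
      obtain u where "e = (u, T)" "(u, T) \<in> E"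
        using \<open>e \<in> exit_edges \<P>\<close> exit_edges_iff edge_to_ttp by (cases e) auto
      moreover from this have "v = T" using that(2) to_ttp by simp
      ultimately show ?thesis using recv(3) by auto
    qed
    then have "addable (Vertex v)" using recv by (auto simp: addable_def events_def)
    then show ?thesis ..
  next
    case (send e)
    obtain v w where "e = (v, w)" by (cases e)
    moreover from this send have "e \<notin> exit_edges \<P>" "(v, w) \<in> E"
      by (auto simp: msg_edges_def exit_edges_def)
    ultimately have "addable (Edge e)"
      using send not_after_exit unfolding addable_def events_def by blast
    then show ?thesis ..
  next
    case (epsilon v w)
    then have "(v, w) \<notin> exit_edges \<P>" by (simp add: exit_edges_def)
    then have "addable (Edge (v, w))"
      using epsilon not_after_exit unfolding addable_def events_def by blast
    then show ?thesis ..
  qed (use trans in auto)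
  then obtain y where y: "addable y" and min: "\<And>x. addable x \<Longrightarrow> rank y \<le> rank x"
    using ex_has_least_nat[of addable] by metis
  have below: "x \<in> s" if "precedes E x y" "x \<in> events V E" for x
  proof (rule ccontr)
    assume "x \<notin> s"
    then have "addable x"
      using that y precedes_trans unfolding addable_def by metis
    with min rank_less[OF that] show False by (meson leD)
  qed
  have "causally_closed V E (s \<union> {y})"
    using closed y below by (auto simp: causally_closed_def addable_def)
  moreover have "\<exists>b. \<not> is_exit b \<and> transition \<P> s b (s \<union> {y})"
  proof (cases y)
    case (Vertex v)
    then have "transition \<P> s (Recv v) (s \<union> {y})"
      using y below by (intro transition.recv) (auto simp: addable_def events_def)
    then show ?thesis by (metis is_exit.simps(2))
  next
    case (Edge e)
    obtain v w where e: "e = (v, w)" by (cases e)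
    then have "(v, w) \<in> E" using y Edge by (auto simp: addable_def events_def)
    show ?thesis
    proof (cases "label \<P> (v, w)")
      case (Msg m)
      then have "transition \<P> s (Send e) (s \<union> {y})"
        using y Edge e \<open>(v, w) \<in> E\<close>
        by (intro transition.send) (auto simp: addable_def msg_edges_def)
      then show ?thesis by (metis is_exit.simps(3))
    next
      case Eps
      then have "transition \<P> s (Epsilon e) (s \<union> {y})"
        using y Edge e \<open>(v, w) \<in> E\<close> below[of "Vertex v"] edges_subset unfolding e
        by (intro transition.epsilon) (auto simp: addable_def events_def)
      then show ?thesis by (metis is_exit.simps(4))
    next
      case Exit
      then show ?thesis
        using y Edge e \<open>(v, w) \<in> E\<close> by (auto simp: addable_def exit_edges_def)
    qed
  qed
  moreover have "s \<subset> s \<union> {y}" using y by (auto simp: addable_def)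
  ultimately show thesis using that by blast
qed

text \<open>Optimism quantifies over closed executions and would be void without one. Extending the
  empty execution stops because there are finitely many events.\<close>

lemma closed_execution_exists: "\<exists>ss as. closed_execution \<P> ss as"
proof -
  have fin: "finite (events V E)"
    using finite_verts finite_edges by (simp add: events_def)
  have "\<exists>ss' as'. closed_execution \<P> ss' as'"
    if "execution \<P> ss as" "\<forall>s\<in>set ss. causally_closed V E s" "\<forall>a\<in>set as. \<not> is_exit a"
    for ss as
    using that
  proof (induction "card (events V E - last ss)" arbitrary: ss as rule: less_induct)
    case less
    have "ss \<noteq> []" using less.prems(1) by (auto simp: execution_def)
    then have closed: "causally_closed V E (last ss)" using less.prems(2) by simp
    show ?case
    proof (cases "\<exists>a s. \<not> is_exit a \<and> transition \<P> (last ss) a s")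
      case True
      then obtain b t where b: "\<not> is_exit b" "transition \<P> (last ss) b t"
        "causally_closed V E t" "last ss \<subset> t"
        using closed_extension[OF closed] by metis
      then have "card (events V E - t) < card (events V E - last ss)"
        using fin by (intro psubset_card_mono) (auto simp: causally_closed_def)
      then show ?thesis
        using less.hyps[of "ss @ [t]" "as @ [b]"] execution_snoc[OF less.prems(1) b(2)]
          less.prems b by auto
    next
      case False
      then have "closed_execution \<P> ss as"
        using less.prems unfolding closed_execution_def by (intro conjI)
      then show ?thesis by blast
    qed
  qed
  from this[of "[{}]" "[]"] show ?thesis
    by (simp add: execution_def causally_closed_def)
qed


section \<open>The trusted third party\<close>

abbreviation "handle \<sigma> v \<equiv> ttp_handle \<P> C A \<sigma> v"
abbreviation "aborted \<sigma> \<equiv> decision \<sigma> = Abort"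

definition ttp_after where
  "ttp_after vs = foldl (\<lambda>\<sigma> v. fst (handle \<sigma> v)) ttp_init vs"

lemma ttp_after_Nil [simp]: "ttp_after [] = ttp_init"
  and ttp_after_snoc [simp]: "ttp_after (vs @ [v]) = fst (handle (ttp_after vs) v)"
  by (simp_all add: ttp_after_def)

lemma ttp_step_exit_message:
  assumes "v \<in> V - {T}"
  shows "ttp_step \<P> C A \<sigma> (exit_message \<P> C v) = handle \<sigma> v"
proof -
  have "(THE w. w \<in> V - {T} \<and> exit_message \<P> C v = exit_message \<P> C w) = v"
    using assms by (intro the_equality) auto
  with assms show ?thesis unfolding ttp_step_def by auto
qed

lemma delta_exit_messages:
  assumes "set vs \<subseteq> V - {T}" "v \<in> V - {T}"
  shows "delta \<P> (map (exit_message \<P> C) (vs @ [v])) = snd (handle (ttp_after vs) v)"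
proof -
  have "foldl (\<lambda>\<sigma> m. fst (ttp_step \<P> C A \<sigma> m)) \<sigma> (map (exit_message \<P> C) vs) =
      foldl (\<lambda>\<sigma> v. fst (handle \<sigma> v)) \<sigma> vs" for \<sigma>
    using assms(1) by (induction vs arbitrary: \<sigma>) (simp_all add: ttp_step_exit_message)
  with assms(2) show ?thesis
    using delta_eq by (simp add: ttp_reply_def ttp_step_exit_message ttp_after_def)
qed

definition accepted where
  "accepted \<sigma> v \<longleftrightarrow> r v \<notin> dishonest \<sigma> \<and> (\<forall>w\<in>evidence \<sigma>. r w \<noteq> r v)"

text \<open>The signers convicted by the evidence \<open>J\<close>: some exit message reports a
  message that the signer sent at or after the vertex \<open>w\<close> where it claimed to
  stop.\<close>

definition exposed :: "'v set \<Rightarrow> 'r set" where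
  "exposed J = {r w |w. w \<in> J \<and> (\<exists>u\<in>J. \<exists>(w', x)\<in>known_before \<P> u. (w, w') \<in> E\<^sup>* \<and> r w' = r w)}"

lemma ttp_handle_rejected:
  assumes "\<not> accepted \<sigma> v"
  shows "handle \<sigma> v = (\<sigma>\<lparr>dishonest := dishonest \<sigma> \<union> {r v}\<rparr>, Abort)"
proof -
  have rejected: "r v \<in> dishonest \<sigma> \<or> (\<exists>w'\<in>evidence \<sigma>. r w' = r v)"
    using assms by (auto simp: accepted_def)
  show ?thesis unfolding ttp_handle_def Let_def if_P[OF rejected] by simp
qed

lemma ttp_handle_init:
  assumes "accepted \<sigma> v" "v \<in> init_set \<P> A"
  shows "handle \<sigma> v = (\<sigma>\<lparr>evidence := insert v (evidence \<sigma>)\<rparr>, decision \<sigma>)"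
proof -
  have not_rejected: "\<not> (r v \<in> dishonest \<sigma> \<or> (\<exists>w'\<in>evidence \<sigma>. r w' = r v))"
    using assms(1) by (auto simp: accepted_def)
  show ?thesis
    unfolding ttp_handle_def Let_def if_not_P[OF not_rejected] if_P[OF assms(2)] by simp
qed

lemma ttp_handle_not_init:
  fixes \<sigma> v
  assumes "accepted \<sigma> v" "v \<notin> init_set \<P> A"
  defines "J \<equiv> insert v (evidence \<sigma>)"
  defines "D \<equiv> dishonest \<sigma> \<union> exposed J"
  defines "d \<equiv> (if \<forall>w\<in>J. r w \<notin> D \<longrightarrow> r w = r v then all_signatures A C else decision \<sigma>)"
  shows "handle \<sigma> v = (\<lparr>evidence = J, dishonest = D, decision = d\<rparr>, d)"
proof -
  have not_rejected: "\<not> (r v \<in> dishonest \<sigma> \<or> (\<exists>w'\<in>evidence \<sigma>. r w' = r v))"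
    using assms(1) by (auto simp: accepted_def)
  have J: "evidence \<sigma> \<union> {v} = J" by (simp add: J_def)
  have "{r w |w. w \<in> J \<and> (\<exists>(w', x)\<in>(\<Union>u\<in>J. known_before \<P> u).
      precedes E (Vertex w) (Edge (w', x)) \<and> r w' = r w)} = exposed J"
    unfolding exposed_def by auto
  then show ?thesis
    unfolding ttp_handle_def Let_def if_not_P[OF not_rejected] if_not_P[OF assms(2)] J
      D_def d_def by simp
qed

lemmas ttp_handle_simps = ttp_handle_rejected ttp_handle_init ttp_handle_not_init

lemma evidence_handle: "evidence (fst (handle \<sigma> v)) =
    (if accepted \<sigma> v then insert v (evidence \<sigma>) else evidence \<sigma>)"
  by (cases "accepted \<sigma> v"; cases "v \<in> init_set \<P> A") (simp_all add: ttp_handle_simps)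

lemma dishonest_handle: "dishonest (fst (handle \<sigma> v)) \<subseteq> dishonest \<sigma> \<union>
    (if accepted \<sigma> v then exposed (insert v (evidence \<sigma>)) else {r v})"
  by (cases "accepted \<sigma> v"; cases "v \<in> init_set \<P> A") (auto simp: ttp_handle_simps)

lemma decision_handle:
  "aborted (fst (handle \<sigma> v)) \<Longrightarrow> aborted \<sigma> \<and> snd (handle \<sigma> v) = Abort"
  "accepted \<sigma> v \<Longrightarrow> snd (handle \<sigma> v) = decision (fst (handle \<sigma> v))"
  by (cases "accepted \<sigma> v"; cases "v \<in> init_set \<P> A"; simp add: ttp_handle_simps split: if_splits)+

lemma exposed_subset: "exposed J \<subseteq> r ` J"
  by (auto simp: exposed_def)

lemma ttp_after_bounds: "evidence (ttp_after vs) \<subseteq> set vs" "dishonest (ttp_after vs) \<subseteq> r ` set vs"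
proof (induction vs rule: rev_induct)
  case Nil
  case 1 show ?case by (simp add: ttp_init_def)
  case 2 show ?case by (simp add: ttp_init_def)
next
  case (snoc v vs)
  case 1 show ?case using snoc by (auto simp: evidence_handle)
  let ?\<sigma> = "ttp_after vs"
  have "dishonest (fst (handle ?\<sigma> v)) \<subseteq> dishonest ?\<sigma> \<union> r ` insert v (evidence ?\<sigma>)"
    using dishonest_handle[of ?\<sigma> v] exposed_subset[of "insert v (evidence ?\<sigma>)"]
    by (cases "accepted ?\<sigma> v") auto
  also have "\<dots> \<subseteq> r ` set (vs @ [v])" using snoc by auto
  finally show "dishonest (ttp_after (vs @ [v])) \<subseteq> r ` set (vs @ [v])" by simp
qed

text \<open>A decision for signatures is never withdrawn, and no other reply than "abort" is given
  before it. So the final decision settles all earlier replies.\<close>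

lemma replies_abort_if_aborted:
  "aborted (ttp_after (us @ v # ts)) \<Longrightarrow> snd (handle (ttp_after us) v) = Abort"
proof (induction ts rule: rev_induct)
  case (snoc x ts)
  then show ?case
    using decision_handle(1)[of "ttp_after (us @ v # ts)" x] ttp_after_snoc[of "us @ v # ts" x]
    by simp
qed (use decision_handle(1) in simp)

text \<open>The TTP keeps its decision "abort" after aborting an honest signer at \<open>v\<close>: that signer
  remains in the evidence without being exposed, so it vetoes every other requester.\<close>

lemma aborted_stable:
  assumes only: "\<And>w. w \<in> set (us @ ts) \<Longrightarrow> r w \<noteq> r v"
    and unexposed: "\<And>u w x. u \<in> set (us @ v # ts) \<Longrightarrow> (w, x) \<in> known_before \<P> u \<Longrightarrow>
      r w = r v \<Longrightarrow> (v, w) \<notin> E\<^sup>*"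
    and abort: "snd (handle (ttp_after us) v) = Abort"
  shows "aborted (ttp_after (us @ v # ts)) \<and> v \<in> evidence (ttp_after (us @ v # ts))"
proof -
  \<comment> \<open>Among these exits only \<open>v\<close> has its role, so exposing that role
    would take a message of it sent at or after \<open>v\<close>, which \<open>unexposed\<close>
    excludes.\<close>
  have exposed: "r v \<notin> exposed J" if "J \<subseteq> set (us @ v # ts)" for J
  proof
    assume "r v \<in> exposed J"
    then obtain w u w' x where *: "w \<in> J" "r w = r v" "u \<in> J" "(w', x) \<in> known_before \<P> u"
        "(w, w') \<in> E\<^sup>*" "r w' = r w"
      by (auto simp: exposed_def)
    then have "w = v" using that only by fastforce
    with * unexposed[of u w' x] that show False by auto
  qed
  have "aborted (ttp_after (us @ v # ts')) \<and> v \<in> evidence (ttp_after (us @ v # ts')) \<and>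
      r v \<notin> dishonest (ttp_after (us @ v # ts'))"
    if "\<exists>ts''. ts = ts' @ ts''" for ts'
    using that
  proof (induction ts' rule: rev_induct)
    case Nil
    have acc: "accepted (ttp_after us) v"
      using ttp_after_bounds[of us] only by (fastforce simp: accepted_def)
    then have "r v \<notin> dishonest (fst (handle (ttp_after us) v))"
      using dishonest_handle[of "ttp_after us" v] ttp_after_bounds(1)[of us]
        exposed[of "insert v (evidence (ttp_after us))"]
      by (auto simp: accepted_def)
    with acc abort show ?case by (simp add: evidence_handle decision_handle(2))
  next
    case (snoc u ts')
    define \<sigma> where "\<sigma> = ttp_after (us @ v # ts')"
    have \<sigma>: "aborted \<sigma>" "v \<in> evidence \<sigma>" "r v \<notin> dishonest \<sigma>"
      using snoc by (auto simp: \<sigma>_def)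
    have u: "u \<in> set ts" "r u \<noteq> r v" and ts': "set ts' \<subseteq> set ts" using snoc.prems only by auto
    have sub: "insert u (evidence \<sigma>) \<subseteq> set (us @ v # ts)"
      using ttp_after_bounds(1)[of "us @ v # ts'"] u(1) ts' by (auto simp: \<sigma>_def)
    have dis: "r v \<notin> dishonest (fst (handle \<sigma> u))"
      using dishonest_handle[of \<sigma> u] \<sigma>(3) exposed[OF sub] u(2) by (auto split: if_splits)
    have "aborted (fst (handle \<sigma> u))"
    proof (cases "accepted \<sigma> u \<and> u \<notin> init_set \<P> A")
      \<comment> \<open>Deciding for signatures needs every vertex of an undisputed signer to have
        role \<open>r u\<close>, but \<open>v\<close> is in the evidence, undisputed, and of another
        role.\<close>
      case True
      then show ?thesis
        using \<sigma> u(2) exposed[OF sub] by (auto simp: ttp_handle_not_init)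
    next
      case False
      then show ?thesis
        using \<sigma>(1) by (cases "accepted \<sigma> u") (auto simp: ttp_handle_simps)
    qed
    with dis \<sigma>(2) show ?case
      using ttp_after_snoc[of "us @ v # ts'" u] by (simp add: evidence_handle \<sigma>_def)
  qed
  then show ?thesis by blast
qed


end


section \<open>Paths from the initial set\<close>

locale optimistic_mpcs = mpcs \<P> C A SigSet
  for \<P> :: "('v, 'r, 'c, 'x) mpcs" and C :: 'c and A :: "'r set" and SigSet :: "'v set" +
  assumes optimistic: "optimistic \<P> A SigSet"
    and no_parallelism: "no_in_role_parallelism \<P> A"
begin

lemma same_role_comparable:
  assumes "v \<in> V" "w \<in> V" "v \<noteq> T" "r v = r w"
  shows "(v, w) \<in> E\<^sup>* \<or> (w, v) \<in> E\<^sup>*"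
  using assms no_parallelism signer_in[of v] by (auto simp: no_in_role_parallelism_def)

lemma end_vertex:
  assumes "Q \<in> A"
  obtains v where "v \<in> V" "v \<noteq> T" "r v = Q"
    "\<And>S. S \<in> A \<Longrightarrow> S \<noteq> Q \<Longrightarrow> \<exists>w x. (w, x) \<in> known \<P> v \<and> r w = S"
proof -
  obtain v where v: "v \<in> end_set \<P> A SigSet" "r v = Q"
    using closed_execution_exists optimistic assms by (auto simp: optimistic_def)
  then have "{r w |w x. (w, x) \<in> known \<P> v \<and> w \<in> sig_vertices \<P> SigSet} \<union> {Q} = A"
    by (auto simp: end_set_def)
  with v show thesis
    by (intro that[of v]) (auto simp: end_set_def)
qed

text \<open>If a signer acts again after its last vertex \<open>i\<close> in the initial set, its next vertex lies
  outside that set, so \<open>i\<close> already knows promises of everybody; if it does not act again, \<open>i\<close>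
  follows the end vertex that exists by optimism.\<close>

lemma all_roles_before_last_init:
  assumes i: "i \<in> last_init_set \<P> A" and S: "S \<in> A" "S \<noteq> r i"
  shows "\<exists>s. r s = S \<and> (s, i) \<in> E\<^sup>+"
proof -
  have iV: "i \<in> V" "i \<noteq> T"
    using i by (auto simp: last_init_set_def init_set_def)
  have "\<exists>s x. (s, x) \<in> E \<and> r s = S \<and> (x, i) \<in> E\<^sup>*"
  proof (cases "\<exists>n. (i, n) \<in> E\<^sup>+ \<and> r n = r i")
    case True
    \<comment> \<open>Take a first later vertex \<open>n\<close> of the same role; by comparability,
      every vertex of this role before \<open>n\<close> is then at or before
      \<open>i\<close>.\<close>
    have "wf (E\<^sup>+)"
      using finite_acyclic_wf[OF finite_edges acyclic_edges] by (rule wf_trancl)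
    moreover obtain n0 where "n0 \<in> {n. (i, n) \<in> E\<^sup>+ \<and> r n = r i}" using True by blast
    ultimately obtain n where "n \<in> {n. (i, n) \<in> E\<^sup>+ \<and> r n = r i}"
      and "\<And>m. (m, n) \<in> E\<^sup>+ \<Longrightarrow> m \<notin> {n. (i, n) \<in> E\<^sup>+ \<and> r n = r i}"
      by (erule wfE_min)
    then have n: "(i, n) \<in> E\<^sup>+" "r n = r i"
      and min: "\<And>m. (m, n) \<in> E\<^sup>+ \<Longrightarrow> \<not> ((i, m) \<in> E\<^sup>+ \<and> r m = r i)"
      by auto
    have "n \<in> V" "n \<noteq> T"
      using trancl_verts[OF n(1)] n(2) iV role_ttp_iff by metis+
    moreover have "n \<notin> init_set \<P> A" using i n by (auto simp: last_init_set_def)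
    ultimately obtain w x where "(w, x) \<in> known_before \<P> n" "r w = S"
      using init_set_iff[of n] S n(2) by auto
    then have w: "(w, x) \<in> E" "(x, n) \<in> E\<^sup>+" "r x = r i" "r w = S"
      using n(2) by (auto simp: known_before_def known_def msg_edges_def)
    then have "(x, i) \<in> E\<^sup>* \<or> (i, x) \<in> E\<^sup>*"
      using same_role_comparable[of i x] trancl_verts[OF w(2)] iV by auto
    with min[OF w(2)] w(3) have "(x, i) \<in> E\<^sup>*" by (metis rtranclD rtrancl.rtrancl_refl)
    with w show ?thesis by blast
  next
    case False
    obtain v where v: "v \<in> V" "r v = r i"
      "\<And>S. S \<in> A \<Longrightarrow> S \<noteq> r i \<Longrightarrow> \<exists>w x. (w, x) \<in> known \<P> v \<and> r w = S"
      using end_vertex[OF signer_in[OF iV]] by metis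
    then have "(v, i) \<in> E\<^sup>*"
      using same_role_comparable[of i v] iV False by (metis rtranclD rtrancl.rtrancl_refl)
    moreover obtain w x where "(w, x) \<in> E" "(x, v) \<in> E\<^sup>*" "r w = S"
      using v(3)[OF S] by (auto simp: known_def msg_edges_def)
    ultimately show ?thesis by (blast intro: rtrancl_trans)
  qed
  then show ?thesis by (blast intro: rtrancl_into_trancl2)
qed

text \<open>\<open>unaware a b\<close>: the exit message of \<open>a\<close> does not prove that the signer of \<open>b\<close> went on
  after \<open>b\<close>.\<close>

definition unaware :: "'v \<Rightarrow> 'v \<Rightarrow> bool" where
  "unaware a b \<longleftrightarrow> (\<forall>w x. (w, x) \<in> known_before \<P> a \<and> r w = r b \<longrightarrow> (b, w) \<notin> E\<^sup>*)"

definition abort_chain :: "'v list \<Rightarrow> bool" where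
  "abort_chain L \<longleftrightarrow> L \<noteq> [] \<and> set L \<subseteq> V - {T} \<and> distinct (map r L) \<and>
     last L \<in> init_set \<P> A \<and> successively unaware L"

text \<open>If \<open>i\<close> has the role of \<open>a\<close>, then \<open>a\<close> comes after
  the last initial vertex of its role. Otherwise \<open>i\<close> and vertices of all further roles
  precede \<open>y\<close>, so \<open>a\<close> knows a message of every other signer and is not
  initial.\<close>

lemma last_init_not_before_init:
  assumes i: "i \<in> last_init_set \<P> A" "(i, y) \<in> E\<^sup>*" "(y, a) \<in> E\<^sup>+"
    and a: "r y = r a" "a \<in> init_set \<P> A"
  shows False
proof (cases "r i = r a")
  case True
  have "(i, a) \<in> E\<^sup>+" using i by (blast intro: rtrancl_trancl_trancl)
  with i(1) a True show False by (auto simp: last_init_set_def)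
next
  case False
  have aV: "a \<in> V" "a \<noteq> T" using a by (auto simp: init_set_def)
  then have yT: "y \<noteq> T" using a(1) role_ttp_iff ttp_vertex_in_verts by metis
  have iy: "(i, y) \<in> E\<^sup>+" using i(2) False a(1) by (metis rtranclD)
  have "\<exists>w x. (w, x) \<in> known_before \<P> a \<and> r w = S" if S: "S \<in> A" "S \<noteq> r a" for S
  proof -
    have "\<exists>s. r s = S \<and> (s, y) \<in> E\<^sup>+"
    proof (cases "S = r i")
      case False
      then show ?thesis
        using all_roles_before_last_init[OF i(1)] S iy by (blast intro: trancl_trans)
    qed (use iy in blast)
    then obtain s where "r s = S" "(s, y) \<in> E\<^sup>+" by blast
    then show ?thesis
      using known_before_message[of s y a] i(3) a(1) S(2) yT by metis
  qed
  then show False using a(2) init_set_iff[OF aV] by blast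
qed

text \<open>Induction along the chain, with the invariant that the path ends at a vertex
  \<open>y\<close> strictly before \<open>a\<close> and of its role. The pattern is reversed because
  moving on in the chain means cutting the path further back, at the last entry of the
  pattern.\<close>

lemma abort_chain_no_path:
  assumes "abort_chain (a # L)" "(y, a) \<in> E\<^sup>+" "r y = r a"
    and "p \<in> paths \<P> (last_init_set \<P> A) y" "subseq (rev (map r L)) (map r p)"
  shows False
  using assms
proof (induction L arbitrary: a y p)
  case Nil
  obtain i p' where p: "p = i # p'" "i \<in> last_init_set \<P> A" "last p = y"
    "successively (\<lambda>a b. (a, b) \<in> E) p"
    using Nil.prems(4) by (cases p) (auto simp: paths_def)
  then have "(i, y) \<in> E\<^sup>*" using successively_rtrancl[of E i p' y] by fastforce
  with p Nil.prems show False
    by (intro last_init_not_before_init[of i y a]) (auto simp: abort_chain_def)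
next
  case (Cons b L)
  have "subseq (rev (map r L) @ [r b]) (map r p)" using Cons.prems(5) by simp
  then obtain ys1 ys2 where ys: "map r p = ys1 @ r b # ys2" "subseq (rev (map r L)) ys1"
    by (elim subseq_snocE)
  then obtain p1 q p2 where p: "p = p1 @ q # p2" "map r p1 = ys1" "r q = r b"
    by (auto simp: map_eq_append_conv map_eq_Cons_conv)
  have path: "successively (\<lambda>a b. (a, b) \<in> E) ((p1 @ [q]) @ p2)" "last p = y" "set p \<subseteq> V"
    "hd p \<in> last_init_set \<P> A"
    using Cons.prems(4) p by (auto simp: paths_def)
  have "successively (\<lambda>a b. (a, b) \<in> E) (q # p2)"
    using path(1) by (auto simp: successively_append_iff successively_Cons)
  then have "(q, y) \<in> E\<^sup>*"
    using successively_rtrancl[of E q p2 y] path(2) p(1) by fastforce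
  moreover have ab: "r a \<noteq> r b" "a \<in> V" "a \<noteq> T" "b \<in> V" "b \<noteq> T" "unaware a b"
    using Cons.prems(1) by (auto simp: abort_chain_def)
  ultimately have "(q, y) \<in> E\<^sup>+" using Cons.prems(3) p(3) by (metis rtranclD)
  moreover have "y \<noteq> T"
    using ab Cons.prems(3) role_ttp_iff ttp_vertex_in_verts by metis
  \<comment> \<open>The signer of \<open>q\<close> sends a message at or after \<open>q\<close> that
    the exit message of \<open>a\<close> reports. As \<open>a\<close> is unaware of
    \<open>b\<close>, it was not sent at or after \<open>b\<close>; comparability then puts
    \<open>q'\<close>, and with it \<open>q\<close>, strictly before \<open>b\<close>.\<close>
  ultimately obtain q' x where q': "(q', x) \<in> known_before \<P> a" "(q, q') \<in> E\<^sup>*" "r q' = r q"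
    using known_before_message[of q y a] Cons.prems(2,3) p(3) ab(1) by metis
  then have "(b, q') \<notin> E\<^sup>*" using ab(6) p(3) by (auto simp: unaware_def)
  moreover have "q' \<in> V"
    using q'(1) source_signer by (auto simp: known_before_def known_def msg_edges_def)
  ultimately have "(q', b) \<in> E\<^sup>+"
    using same_role_comparable[of b q'] ab q'(3) p(3) by (metis rtranclD rtrancl.rtrancl_refl)
  with q'(2) have "(q, b) \<in> E\<^sup>+" by (rule rtrancl_trancl_trancl)
  moreover have "p1 @ [q] \<in> paths \<P> (last_init_set \<P> A) q"
    using path p(1) unfolding paths_def
    by (auto simp: successively_append_iff hd_append split: if_splits)
  moreover have "abort_chain (b # L)"
    using Cons.prems(1) by (auto simp: abort_chain_def)
  moreover have "subseq (rev (map r L)) (map r (p1 @ [q]))"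
    using ys(2) p(2) by (simp add: list_emb_prefix)
  ultimately show False using Cons.IH[of b q "p1 @ [q]"] p(3) by blast
qed


section \<open>Fairness\<close>

text \<open>While the decision stays "abort", an accepted exit outside the initial set is blocked by
  an unexposed exit \<open>u\<close> of another role, and is prepended to the chain of
  \<open>u\<close>. Keeping chains inside the evidence makes the roles distinct, since an accepted
  exit has a role new to the evidence.\<close>

lemma evidence_abort_chain:
  assumes "set vs \<subseteq> V - {T}" "aborted (ttp_after vs)" "w \<in> evidence (ttp_after vs)"
  shows "\<exists>L. abort_chain (w # L) \<and> set L \<subseteq> evidence (ttp_after vs)"
  using assms
proof (induction vs arbitrary: w rule: rev_induct)
  case Nil
  then show ?case by (simp add: ttp_init_def)
next
  case (snoc v vs)
  define \<sigma> where "\<sigma> = ttp_after vs"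
  have aborted: "aborted (fst (handle \<sigma> v))" "aborted \<sigma>"
    using snoc.prems(2) decision_handle(1)[of \<sigma> v] by (auto simp: \<sigma>_def)
  have IH: "\<exists>L. abort_chain (u # L) \<and> set L \<subseteq> evidence \<sigma>" if "u \<in> evidence \<sigma>" for u
    using snoc.IH[of u] snoc.prems(1) aborted(2) that by (auto simp: \<sigma>_def)
  have mono: "evidence \<sigma> \<subseteq> evidence (ttp_after (vs @ [v]))"
    by (auto simp: evidence_handle \<sigma>_def)
  show ?case
  proof (cases "w \<in> evidence \<sigma>")
    case True
    with IH mono show ?thesis by blast
  next
    case False
    then have acc: "accepted \<sigma> v" and w: "w = v"
      using snoc.prems(3) by (auto simp: evidence_handle \<sigma>_def split: if_splits)
    have vV: "v \<in> V - {T}" using snoc.prems(1) by simp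
    show ?thesis
    proof (cases "v \<in> init_set \<P> A")
      case True
      with vV w show ?thesis by (intro exI[of _ "[]"]) (simp add: abort_chain_def)
    next
      case False
      obtain u where u: "u \<in> insert v (evidence \<sigma>)"
        "r u \<notin> exposed (insert v (evidence \<sigma>))" "r u \<noteq> r v"
        using aborted(1) acc False by (auto simp: ttp_handle_not_init split: if_splits)
      then have "u \<in> evidence \<sigma>" by auto
      with IH obtain L where L: "abort_chain (u # L)" "set L \<subseteq> evidence \<sigma>" by blast
      have "unaware v u" unfolding unaware_def
      proof (intro allI impI notI)
        fix w' x assume "(w', x) \<in> known_before \<P> v \<and> r w' = r u" "(u, w') \<in> E\<^sup>*"
        then have "r u \<in> exposed (insert v (evidence \<sigma>))"
          using u(1) by (auto simp: exposed_def)
        with u(2) show False by simp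
      qed
      moreover have "r v \<notin> r ` set (u # L)"
        using acc L(2) \<open>u \<in> evidence \<sigma>\<close> by (auto simp: accepted_def)
      ultimately have "abort_chain (v # u # L)"
        using L(1) vV by (auto simp: abort_chain_def)
      moreover have "set (u # L) \<subseteq> evidence (ttp_after (vs @ [v]))"
        using L(2) \<open>u \<in> evidence \<sigma>\<close> mono by auto
      ultimately show ?thesis unfolding w by blast
    qed
  qed
qed

lemma no_abort_after_all_permutations:
  assumes chain: "abort_chain (v # L)" and z: "(z, v) \<in> E\<^sup>+" "r z = r v"
    and perms: "contains_all_permutations \<P> (last_init_set \<P> A) z (A - {r v})"
  shows False
proof -
  have "r v \<notin> set (map r L)" "set (map r L) \<subseteq> A"
    and distinct: "distinct (map r L)"
    using chain signer_in by (auto simp: abort_chain_def)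
  then have L: "set (map r L) \<subseteq> A - {r v}" by blast
  \<comment> \<open>The signers missing from the chain are placed first, which leaves the reversed
    chain as a suffix of the permutation.\<close>
  obtain others where "set others = A - {r v} - set (map r L)" "distinct others"
    using finite_distinct_list finite_signers by (metis finite_Diff)
  then have "others @ rev (map r L) \<in> permutations_of_set (A - {r v})"
    using L distinct by (auto simp: permutations_of_set_def)
  then obtain p where p: "p \<in> paths \<P> (last_init_set \<P> A) z"
      "subseq (others @ rev (map r L)) (map r p)"
    using perms unfolding contains_all_permutations_def role_seqs_def by blast
  have "subseq (rev (map r L)) (others @ rev (map r L))"
    by (intro list_emb_append2) simp
  then have "subseq (rev (map r L)) (map r p)"
    using p(2) by (rule subseq_order.trans)
  with abort_chain_no_path[OF chain z] p(1) show False by blast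
qed

text \<open>For the second part: a message sent at or after \<open>v\<close> would, by closedness in
  the signer's subgraph, force \<open>v\<close> itself into the state, which honesty forbids after
  the exit.\<close>

lemma honest_exit:
  assumes "honest_state \<P> (r v) (s \<inter> events (role_verts \<P> (r v)) (role_edges \<P> (r v)))"
    and v: "v \<in> V" "v \<noteq> T" "Edge (v, T) \<in> s"
  shows "\<And>u. u \<in> V \<Longrightarrow> u \<noteq> T \<Longrightarrow> r u = r v \<Longrightarrow> Edge (u, T) \<in> s \<Longrightarrow> u = v"
    and "\<And>w x. (w, x) \<in> msg_edges \<P> \<Longrightarrow> r w = r v \<Longrightarrow> Edge (w, x) \<in> s \<Longrightarrow> (v, w) \<notin> E\<^sup>*"
proof -
  let ?V = "role_verts \<P> (r v)" and ?E = "role_edges \<P> (r v)"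
  let ?s = "s \<inter> events ?V ?E"
  have exit_in: "Edge (u, T) \<in> ?s" if "u \<in> V" "u \<noteq> T" "r u = r v" "Edge (u, T) \<in> s" for u
    using that edge_to_ttp by (auto simp: events_def role_edges_def)
  have exit: "(u, T) \<in> exit_edges \<P>" if "u \<in> V" "u \<noteq> T" for u
    using that by (simp add: exit_edges_iff)
  from assms(1) have "\<forall>e\<in>exit_edges \<P>. \<forall>e'\<in>exit_edges \<P>. Edge e \<in> ?s \<and> Edge e' \<in> ?s \<longrightarrow> e = e'"
    unfolding honest_state_def by blast
  then show "u = v" if "u \<in> V" "u \<noteq> T" "r u = r v" "Edge (u, T) \<in> s" for u
    using exit_in[OF that] exit_in[OF v(1,2) refl v(3)] exit[OF that(1,2)] exit[OF v(1,2)] by blast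
  have closed: "Vertex v \<notin> ?s" "causally_closed ?V ?E (?s - {Edge (v, T)})"
    using assms(1) exit[OF v(1,2)] exit_in[OF v(1,2) refl v(3)]
    unfolding honest_state_def by blast+
  show "(v, w) \<notin> E\<^sup>*" if w: "(w, x) \<in> msg_edges \<P>" "r w = r v" "Edge (w, x) \<in> s" for w x
  proof
    assume "(v, w) \<in> E\<^sup>*"
    then have "precedes ?E (Vertex v) (Edge (w, x))"
      using same_role_path w(2) by simp
    moreover have "x \<noteq> T" "Edge (w, x) \<in> ?s"
      using w by (auto simp: msg_edges_iff events_def role_edges_def)
    moreover have "(v, T) \<in> ?E"
      using edge_to_ttp v by (simp add: role_edges_def)
    then have "Vertex v \<in> events ?V ?E"
      by (auto simp: events_def role_verts_def Field_def)
    ultimately have "Vertex v \<in> ?s"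
      using closed(2) unfolding causally_closed_def by blast
    with closed(1) show False by simp
  qed
qed

text \<open>If no exit of \<open>P\<close> is answered by "abort", the last disjunct of
  \<open>fair_execution\<close> holds; otherwise the first one does.\<close>

lemma fair_if_all_permutations:
  assumes exec: "execution \<P> ss as" and honest: "honest \<P> P ss"
    and perms: "\<And>v. v \<in> sig_vertices \<P> SigSet \<Longrightarrow> r v = P \<Longrightarrow>
           contains_all_permutations \<P> (last_init_set \<P> A) v (A - {P})"
  shows "fair_execution \<P> C A SigSet P ss as"
proof (cases "\<exists>v w i. (v, w) \<in> exit_edges \<P> \<and> r v = P \<and> i < length as \<and>
    as ! i = Take_exit (v, w) \<and> reply_at \<P> C as i = Abort")
  case False
  then show ?thesis unfolding fair_execution_def by blast
next
  case True
  then obtain v i where v: "v \<in> V" "v \<noteq> T" "r v = P" and i: "i < length as"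
    "as ! i = Take_exit (v, T)" "reply_at \<P> C as i = Abort"
    by (auto simp: exit_edges_iff)
  define us where "us = exits (take i as)"
  define ts where "ts = exits (drop (Suc i) as)"
  have as_split: "exits as = us @ v # ts"
    using id_take_nth_drop[OF i(1)] i(2) unfolding us_def ts_def
    by (metis exits.simps(2) exits_append)
  have exits_take: "exits (take (Suc k) as) = exits (take k as) @ [u]"
    if "k < length as" "as ! k = Take_exit (u, w)" for k u w
    using that by (simp add: take_Suc_conv_app_nth exits_append)
  have exit_vertex: "u \<in> V" "u \<noteq> T" "w = T"
    if "k < length as" "as ! k = Take_exit (u, w)" for k u w
    using execution_exit_edge(1)[OF exec that] by (auto simp: exit_edges_iff)
  have exits_verts: "set (exits bs) \<subseteq> V - {T}" if bs: "set bs \<subseteq> set as" for bs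
  proof
    fix u assume "u \<in> set (exits bs)"
    then obtain w where "Take_exit (u, w) \<in> set as" using bs unfolding in_exits_iff by blast
    then obtain k where "k < length as" "as ! k = Take_exit (u, w)" by (meson in_set_conv_nth)
    from exit_vertex[OF this] show "u \<in> V - {T}" by simp
  qed
  have in_last: "Edge (u, w) \<in> last ss" if "k < length as" "as ! k = Take_exit (u, w)" for k u w
    using execution_exit_edge(3)[OF exec that] execution_subset_last[OF exec, of "Suc k"] that(1)
    by auto
  have "last ss \<in> set ss" using exec by (intro last_in_set) (auto simp: execution_def)
  then have "honest_state \<P> (r v) (last ss \<inter> events (role_verts \<P> (r v)) (role_edges \<P> (r v)))"
    using honest v(3) by (auto simp: honest_def)
  note honest_facts = honest_exit[OF this v(1,2) in_last[OF i(1,2)]]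
  \<comment> \<open>Honesty leaves \<open>P\<close> a single exit edge, and no edge is taken
    twice.\<close>
  have once: "k = i" if "k < length as" "as ! k = Take_exit (u, w)" "r u = P" for k u w
    using honest_facts(1)[of u] exit_vertex[OF that(1,2)] in_last[OF that(1,2)] that v(3) i
      execution_exit_once[OF exec that(1) i(1)] by auto
  have only: "r u \<noteq> r v" if u: "u \<in> set (us @ ts)" for u
  proof
    assume "r u = r v"
    from u consider w where "Take_exit (u, w) \<in> set (take i as)"
      | w where "Take_exit (u, w) \<in> set (drop (Suc i) as)"
      by (auto simp: us_def ts_def in_exits_iff)
    then obtain k w where "k < length as" "as ! k = Take_exit (u, w)" "k \<noteq> i"
    proof cases
      case 1
      then show thesis using that by (auto simp: in_set_conv_nth)
    next
      case (2 w)
      then obtain k where "k < length as - Suc i" "as ! (Suc i + k) = Take_exit (u, w)"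
        by (auto simp: in_set_conv_nth)
      then show thesis using that[of "Suc i + k"] by auto
    qed
    with once \<open>r u = r v\<close> v(3) show False by blast
  qed
  \<comment> \<open>Even a dishonest signer can exit at \<open>u\<close> only after its earlier
    receive events, which need their incoming edges. So reported messages of \<open>P\<close> were
    really sent, and the honest \<open>P\<close> sent none at or after \<open>v\<close>.\<close>
  have unexposed: "(v, w) \<notin> E\<^sup>*"
    if u: "u \<in> set (us @ v # ts)" and w: "(w, x) \<in> known_before \<P> u" "r w = r v" for u w x
  proof -
    obtain k w' where k: "k < length as" "as ! k = Take_exit (u, w')"
      using u unfolding as_split[symmetric] in_exits_iff by (auto simp: in_set_conv_nth)
    have x: "(x, u) \<in> E\<^sup>+" "r x = r u" "(w, x) \<in> msg_edges \<P>" "(w, x) \<in> E"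
      using w(1) by (auto simp: known_before_def known_def msg_edges_def)
    then have "Vertex x \<in> ss ! k" using execution_exit_edge(4)[OF exec k] by simp
    then have "Edge (w, x) \<in> ss ! k" using execution_incoming[OF exec _ _ x(4)] k(1) by simp
    then have "Edge (w, x) \<in> last ss" using execution_subset_last[OF exec, of k] k(1) by auto
    with honest_facts(2) x(3) w(2) show ?thesis by blast
  qed
  have reply: "reply_at \<P> C as k = snd (handle (ttp_after (exits (take k as))) u)"
    if "k < length as" "as ! k = Take_exit (u, w)" for k u w
    using delta_exit_messages[OF exits_verts[of "take k as"], of u] exit_vertex[OF that]
      exits_take[OF that]
    by (simp add: reply_at_def sent_to_ttp_eq set_take_subset)
  have "snd (handle (ttp_after us) v) = Abort"
    using reply[OF i(1,2)] i(3) by (simp add: us_def)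
  from aborted_stable[OF only unexposed this]
  have final: "aborted (ttp_after (exits as))" "v \<in> evidence (ttp_after (exits as))"
    unfolding as_split by auto
  have "reply_at \<P> C as k \<noteq> all_signatures A C" if "k < length as" "is_exit (as ! k)" for k
  proof -
    obtain u w where k: "as ! k = Take_exit (u, w)"
      using \<open>is_exit (as ! k)\<close> by (cases "as ! k") auto
    have "exits as = exits (take k as) @ u # exits (drop (Suc k) as)"
      using id_take_nth_drop[OF that(1)] k by (metis exits.simps(2) exits_append)
    then have "reply_at \<P> C as k = Abort"
      using reply[OF that(1) k] replies_abort_if_aborted final(1) by metis
    then show ?thesis by (metis all_signatures_neq_Abort)
  qed
  \<comment> \<open>A signature sent at \<open>z\<close> must precede the exit at \<open>v\<close>,
    so the paths to \<open>z\<close> contradict the chain that explains the reply.\<close>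
  moreover have False
    if z: "(z, w) \<in> msg_edges \<P>" "Edge (z, w) \<in> last ss" "r z = P" "z \<in> sig_vertices \<P> SigSet"
    for z w
  proof -
    have "(v, z) \<notin> E\<^sup>*" using honest_facts(2)[OF z(1)] z v(3) by simp
    moreover have "z \<in> V" using z(1) source_signer by (auto simp: msg_edges_iff)
    ultimately have "(z, v) \<in> E\<^sup>+"
      using same_role_comparable[of v z] v z(3) by (metis rtranclD rtrancl.rtrancl_refl)
    moreover obtain L where "abort_chain (v # L)"
      using evidence_abort_chain[OF exits_verts final] by blast
    ultimately show False
      using no_abort_after_all_permutations perms[OF z(4,3)] z(3) v(3) by metis
  qed
  ultimately show ?thesis unfolding fair_execution_def by blast
qed

end

theorem theorem3:
  fixes \<P> :: "('v, 'r, 'c, 'x) mpcs" and C :: 'c and A :: "'r set" and SigSet :: "'v set"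
    and P :: 'r
  assumes "mpcs_protocol \<P> C A SigSet"
    and "optimistic \<P> A SigSet"
    and "no_in_role_parallelism \<P> A"
    and "P \<in> A"
    and "\<And>v. v \<in> sig_vertices \<P> SigSet \<Longrightarrow> role \<P> v = P \<Longrightarrow>
           contains_all_permutations \<P> (last_init_set \<P> A) v (A - {P})"
  shows "fair_for \<P> C A SigSet P"
proof -
  interpret optimistic_mpcs \<P> C A SigSet
    using assms(1-3) by unfold_locales
  show ?thesis
    using fair_if_all_permutations assms(5) unfolding fair_for_def by blast
qed

end
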